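(* A Kripke model $\mathcal{W}$ admits arbitrarily large finite families of independent switches if and only if it admits arbitrarily large finite dials.
   Context: Assertions are taken from a class closed under finite Boolean combinations (including finite disjunctions). A statement $s$ is a switch in $\mathcal{W}$ if both $\Diamond s$ and $\Diamond\neg s$ are true at every world. A family of switches is independent if at every world one can access a world realizing any desired finite pattern of truth values for finitely many of the switches. A finite list of statements $d_0,\dots,d_{n-1}$ is a dial (of size $n$) in $\mathcal{W}$ if every world satisfies exactly one of the $d_i$, and every world can access a world satisfying $d_i$ for any prescribed $i<n$. *)

theory Defs
  imports Main
begin

text \<open>
  The class of assertions is kept abstract: any class of sentences with a satisfaction relation
  that is closed under connectives interpreted in the Boolean way at every world. It need not be
  closed under the modal operators. No condition is imposed on the accessibility relation.
\<close>

record ('w, 'f) kripke =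
  worlds :: "'w set"
  access :: "('w \<times> 'w) set"
  assertions :: "'f set"
  sat :: "'w \<Rightarrow> 'f \<Rightarrow> bool"
  Neg :: "'f \<Rightarrow> 'f"
  Conj :: "'f \<Rightarrow> 'f \<Rightarrow> 'f"
  Disj :: "'f \<Rightarrow> 'f \<Rightarrow> 'f"

locale kripke_model =
  fixes M :: "('w, 'f) kripke"
  assumes access_worlds: "access M \<subseteq> worlds M \<times> worlds M"
    and Neg_closed: "p \<in> assertions M \<Longrightarrow> Neg M p \<in> assertions M"
    and Conj_closed: "\<lbrakk>p \<in> assertions M; q \<in> assertions M\<rbrakk> \<Longrightarrow> Conj M p q \<in> assertions M"
    and Disj_closed: "\<lbrakk>p \<in> assertions M; q \<in> assertions M\<rbrakk> \<Longrightarrow> Disj M p q \<in> assertions M"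
    and sat_Neg: "\<lbrakk>w \<in> worlds M; p \<in> assertions M\<rbrakk> \<Longrightarrow> sat M w (Neg M p) \<longleftrightarrow> \<not> sat M w p"
    and sat_Conj: "\<lbrakk>w \<in> worlds M; p \<in> assertions M; q \<in> assertions M\<rbrakk>
      \<Longrightarrow> sat M w (Conj M p q) \<longleftrightarrow> sat M w p \<and> sat M w q"
    and sat_Disj: "\<lbrakk>w \<in> worlds M; p \<in> assertions M; q \<in> assertions M\<rbrakk>
      \<Longrightarrow> sat M w (Disj M p q) \<longleftrightarrow> sat M w p \<or> sat M w q"

definition sat_possibly :: "('w, 'f) kripke \<Rightarrow> 'w \<Rightarrow> 'f \<Rightarrow> bool" where
  "sat_possibly M w p \<longleftrightarrow> (\<exists>v. (w, v) \<in> access M \<and> sat M v p)"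

definition switch :: "('w, 'f) kripke \<Rightarrow> 'f \<Rightarrow> bool" where
  "switch M s \<longleftrightarrow> s \<in> assertions M \<and>
    (\<forall>w\<in>worlds M. sat_possibly M w s \<and> sat_possibly M w (Neg M s))"

definition independent_switches :: "('w, 'f) kripke \<Rightarrow> 'i set \<Rightarrow> ('i \<Rightarrow> 'f) \<Rightarrow> bool" where
  "independent_switches M I s \<longleftrightarrow> (\<forall>i\<in>I. switch M (s i)) \<and>
    (\<forall>w\<in>worlds M. \<forall>J b. finite J \<and> J \<subseteq> I \<longrightarrow>
      (\<exists>v. (w, v) \<in> access M \<and> (\<forall>j\<in>J. sat M v (s j) \<longleftrightarrow> b j)))"

definition dial :: "('w, 'f) kripke \<Rightarrow> nat \<Rightarrow> (nat \<Rightarrow> 'f) \<Rightarrow> bool" where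
  "dial M n d \<longleftrightarrow> (\<forall>i<n. d i \<in> assertions M) \<and>
    (\<forall>w\<in>worlds M. \<exists>!i. i < n \<and> sat M w (d i)) \<and>
    (\<forall>w\<in>worlds M. \<forall>i<n. sat_possibly M w (d i))"

end

theory Submission
  imports Defs
begin

text \<open>
  From independent switches \<open>s\<^sub>0, \<dots>, s\<^bsub>m-1\<^esub>\<close> one gets a dial of size \<open>m + 1\<close> by recording the
  least \<open>i\<close> for which \<open>s\<^sub>i\<close> is true, with the value \<open>m\<close> if all switches are off. Conversely,
  given a dial of size at least \<open>2^n\<close>, the binary digits \<open>0, \<dots>, n-1\<close> of the dial value are
  \<open>n\<close> independent switches, since every pattern of digits is that of some number below \<open>2^n\<close>.
\<close>

context kripke_model
begin

text \<open>Truth conditions stand in for formulas, so iterated connectives need not be written out.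
  Agreement is asked only on \<open>worlds M\<close>, where the connectives are known to be
  Boolean.\<close>

definition definable :: "('w \<Rightarrow> bool) \<Rightarrow> bool" where
  "definable P \<longleftrightarrow> (\<exists>p\<in>assertions M. \<forall>w\<in>worlds M. sat M w p \<longleftrightarrow> P w)"

lemma definable_sat: "p \<in> assertions M \<Longrightarrow> definable (\<lambda>w. sat M w p)"
  by (auto simp: definable_def)

lemma definable_not:
  assumes "definable P"
  shows "definable (\<lambda>w. \<not> P w)"
  using assms Neg_closed sat_Neg unfolding definable_def by metis

lemma definable_and:
  assumes "definable P" and "definable Q"
  shows "definable (\<lambda>w. P w \<and> Q w)"
  using assms Conj_closed sat_Conj unfolding definable_def by metis

lemma definable_or:
  assumes "definable P" and "definable Q"
  shows "definable (\<lambda>w. P w \<or> Q w)"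
  using assms Disj_closed sat_Disj unfolding definable_def by metis

text \<open>There is no constant for truth among the connectives; excluded middle for some assertion
  replaces it. This is the base case for finite conjunctions.\<close>

lemma definable_True:
  assumes "assertions M \<noteq> {}"
  shows "definable (\<lambda>w. True)"
proof -
  obtain p where "p \<in> assertions M"
    using assms by blast
  then have "definable (\<lambda>w. sat M w p \<or> \<not> sat M w p)"
    by (intro definable_or definable_not definable_sat)
  then show ?thesis
    by simp
qed

lemma definable_ball:
  assumes "assertions M \<noteq> {}" and "finite I" and "\<And>i. i \<in> I \<Longrightarrow> definable (P i)"
  shows "definable (\<lambda>w. \<forall>i\<in>I. P i w)"
  using assms(2,3)
  by (induction I) (simp_all add: definable_True[OF assms(1)] definable_and)

lemma definable_bex:
  assumes "assertions M \<noteq> {}" and "finite I" and "\<And>i. i \<in> I \<Longrightarrow> definable (P i)"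
  shows "definable (\<lambda>w. \<exists>i\<in>I. P i w)"
  using definable_not[OF definable_ball[of I "\<lambda>i w. \<not> P i w"]] assms definable_not by simp

lemma definable_family:
  assumes "\<And>i. i \<in> I \<Longrightarrow> definable (P i)"
  shows "\<exists>p. \<forall>i\<in>I. p i \<in> assertions M \<and> (\<forall>w\<in>worlds M. sat M w (p i) \<longleftrightarrow> P i w)"
  using assms by (intro bchoice) (auto simp: definable_def)

lemma access_target: "(w, v) \<in> access M \<Longrightarrow> v \<in> worlds M"
  using access_worlds by blast

lemma dial_of_independent_switches:
  fixes s :: "nat \<Rightarrow> 'f"
  assumes s: "independent_switches M {..<m} s" and "0 < m"
  shows "\<exists>d. dial M (Suc m) d"
proof -
  have in_assertions: "s i \<in> assertions M" if "i < m" for i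
    using s that by (auto simp: independent_switches_def switch_def)
  then have nonempty: "assertions M \<noteq> {}"
    using \<open>0 < m\<close> by blast
  \<comment> \<open>The guard \<open>i < m\<close> lets the same formula express the all-off value
    \<open>i = m\<close>.\<close>
  define P where "P i w \<longleftrightarrow> (\<forall>j\<in>{..<i}. \<not> sat M w (s j)) \<and> (i < m \<longrightarrow> sat M w (s i))"
    for i w
  have "definable (P i)" if "i \<in> {..<Suc m}" for i
  proof -
    have "definable (\<lambda>w. \<forall>j\<in>{..<i}. \<not> sat M w (s j))"
      using that by (intro definable_ball definable_not definable_sat in_assertions nonempty) auto
    moreover have "definable (\<lambda>w. i < m \<longrightarrow> sat M w (s i))"
      by (cases "i < m") (simp_all add: definable_sat in_assertions definable_True nonempty)
    ultimately show ?thesis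
      unfolding P_def by (rule definable_and)
  qed
  then obtain d where d: "\<And>i. i \<in> {..<Suc m} \<Longrightarrow> d i \<in> assertions M"
    and sat_d: "\<And>i w. i \<in> {..<Suc m} \<Longrightarrow> w \<in> worlds M \<Longrightarrow> sat M w (d i) \<longleftrightarrow> P i w"
    using definable_family[of "{..<Suc m}" P] by blast
  have "\<exists>!i. i < Suc m \<and> sat M w (d i)" if w: "w \<in> worlds M" for w
  proof -
    \<comment> \<open>The disjunct \<open>i = m\<close> ensures that a least element exists and is
      at most \<open>m\<close>.\<close>
    define k where "k = (LEAST i. i = m \<or> sat M w (s i))"
    have k: "k = m \<or> sat M w (s k)"
      unfolding k_def by (rule LeastI[of _ m]) simp
    have "k \<le> m"
      unfolding k_def by (rule Least_le) simp
    moreover have "\<not> sat M w (s j)" if "j < k" for j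
      using that not_less_Least unfolding k_def by blast
    ultimately have "k < Suc m \<and> P k w"
      using k by (auto simp: P_def)
    \<comment> \<open>If \<open>i < j\<close>, then \<open>i < m\<close>, so \<open>P i w\<close>
      makes \<open>s i\<close> true while \<open>P j w\<close> makes it false.\<close>
    moreover have "i = j" if "i < Suc m" "P i w" "j < Suc m" "P j w" for i j
      using that by (cases i j rule: linorder_cases) (auto simp: P_def)
    ultimately show ?thesis
      using sat_d w by (metis lessThan_iff)
  qed
  moreover have "sat_possibly M w (d i)" if w: "w \<in> worlds M" and i: "i < Suc m" for w i
  proof -
    have "\<forall>J b. finite J \<and> J \<subseteq> {..<m} \<longrightarrow>
        (\<exists>v. (w, v) \<in> access M \<and> (\<forall>j\<in>J. sat M v (s j) \<longleftrightarrow> b j))"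
      using s w unfolding independent_switches_def by blast
    \<comment> \<open>The pattern with only \<open>s i\<close> on; for \<open>i = m\<close> it is
      the all-off pattern.\<close>
    from this[rule_format, of "{..<m}" "\<lambda>j. j = i"]
    obtain v where v: "(w, v) \<in> access M" "\<forall>j\<in>{..<m}. sat M v (s j) \<longleftrightarrow> j = i"
      by auto
    then have "P i v"
      using i by (auto simp: P_def)
    then show ?thesis
      using v(1) sat_d i access_target unfolding sat_possibly_def by blast
  qed
  ultimately have "dial M (Suc m) d"
    using d by (simp add: dial_def)
  then show ?thesis
    by blast
qed

text \<open>A pattern on all of \<open>I\<close> restricts to each \<open>J\<close>, and the two
  constant patterns give the switch conditions.\<close>

lemma independent_switchesI:
  assumes in_assertions: "\<And>i. i \<in> I \<Longrightarrow> s i \<in> assertions M"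
    and pattern: "\<And>w b. w \<in> worlds M \<Longrightarrow> \<exists>v. (w, v) \<in> access M \<and> (\<forall>i\<in>I. sat M v (s i) \<longleftrightarrow> b i)"
  shows "independent_switches M I s"
  unfolding independent_switches_def switch_def sat_possibly_def
proof (intro conjI ballI allI impI)
  fix i w assume i: "i \<in> I" and w: "w \<in> worlds M"
  show "\<exists>v. (w, v) \<in> access M \<and> sat M v (s i)"
    using pattern[OF w, of "\<lambda>_. True"] i by blast
  show "\<exists>v. (w, v) \<in> access M \<and> sat M v (Neg M (s i))"
    using pattern[OF w, of "\<lambda>_. False"] i sat_Neg in_assertions access_target by blast
next
  fix w J b assume w: "w \<in> worlds M" and "finite J \<and> J \<subseteq> I"
  then show "\<exists>v. (w, v) \<in> access M \<and> (\<forall>j\<in>J. sat M v (s j) \<longleftrightarrow> b j)"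
    using pattern[OF w, of b] by blast
qed (rule in_assertions)

lemma independent_switches_of_dial:
  assumes d: "dial M m d" and m: "2 ^ n \<le> m"
  shows "\<exists>s :: nat \<Rightarrow> 'f. independent_switches M {..<n} s"
proof -
  have in_assertions: "d i \<in> assertions M" if "i < m" for i
    using d that by (auto simp: dial_def)
  have unique: "i = j" if "i < m" "sat M w (d i)" "j < m" "sat M w (d j)" "w \<in> worlds M" for i j w
    using d that unfolding dial_def by blast
  have "0 < m"
    using m by (simp add: less_le_trans[of 0 "2 ^ n"])
  then have nonempty: "assertions M \<noteq> {}"
    using in_assertions by blast
  \<comment> \<open>All values below \<open>m\<close> are read, not only those below
    \<open>2 ^ n\<close>; larger ones merely repeat patterns of the lowest \<open>n\<close>
    digits.\<close>
  have "definable (\<lambda>w. \<exists>i\<in>{i. i < m \<and> bit i j}. sat M w (d i))" for j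
    by (intro definable_bex definable_sat in_assertions nonempty) auto
  then obtain s where s: "\<And>j. j \<in> {..<n} \<Longrightarrow> s j \<in> assertions M"
    and sat_s: "\<And>j w. j \<in> {..<n} \<Longrightarrow> w \<in> worlds M \<Longrightarrow>
      sat M w (s j) \<longleftrightarrow> (\<exists>i\<in>{i. i < m \<and> bit i j}. sat M w (d i))"
    using definable_family[of "{..<n}" "\<lambda>j w. \<exists>i\<in>{i. i < m \<and> bit i j}. sat M w (d i)"] by blast
  have "independent_switches M {..<n} s"
  proof (rule independent_switchesI)
    fix w b assume w: "w \<in> worlds M"
    \<comment> \<open>The number with binary digits \<open>b 0\<close>, ..., \<open>b (n-1)\<close>,
      least significant first.\<close>
    define k :: nat where "k = horner_sum of_bool 2 (map b [0..<n])"
    have "k < 2 ^ n"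
      using horner_sum_of_bool_2_less[of "map b [0..<n]", where 'a = nat] by (simp add: k_def)
    then have k: "k < m"
      using m by simp
    have bit_k: "bit k j \<longleftrightarrow> b j" if "j < n" for j
      using that by (simp add: k_def bit_horner_sum_bit_iff)
    obtain v where v: "(w, v) \<in> access M" "sat M v (d k)"
      using d w k unfolding dial_def sat_possibly_def by blast
    \<comment> \<open>Uniqueness of the dial value at \<open>v\<close> reduces the disjunction
      behind \<open>s j\<close> to the single digit \<open>bit k j\<close>.\<close>
    then have value_k: "i < m \<and> sat M v (d i) \<longleftrightarrow> i = k" for i
      using unique[of i v k] k access_target by blast
    have "sat M v (s j) \<longleftrightarrow> b j" if "j \<in> {..<n}" for j
    proof -
      have "sat M v (s j) \<longleftrightarrow> (\<exists>i. (i < m \<and> sat M v (d i)) \<and> bit i j)"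
        using sat_s[OF that access_target[OF v(1)]] by blast
      also have "\<dots> \<longleftrightarrow> bit k j"
        unfolding value_k by simp
      finally show ?thesis
        using bit_k that by simp
    qed
    then show "\<exists>v. (w, v) \<in> access M \<and> (\<forall>i\<in>{..<n}. sat M v (s i) \<longleftrightarrow> b i)"
      using v(1) by blast
  qed (rule s)
  then show ?thesis
    by blast
qed

end

theorem theorem4:
  fixes M :: "('w, 'f) kripke"
  assumes "kripke_model M"
  shows "(\<forall>n. \<exists>m\<ge>n. \<exists>s :: nat \<Rightarrow> 'f. independent_switches M {..<m} s) \<longleftrightarrow>
         (\<forall>n. \<exists>m\<ge>n. \<exists>d. dial M m d)"
proof (intro iffI allI)
  interpret kripke_model M by fact
  fix n
  assume "\<forall>n. \<exists>m\<ge>n. \<exists>s :: nat \<Rightarrow> 'f. independent_switches M {..<m} s"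
  \<comment> \<open>Asking for \<open>Suc n\<close> switches secures \<open>0 < m\<close> even when
    \<open>n = 0\<close>.\<close>
  then obtain m and s :: "nat \<Rightarrow> 'f" where "Suc n \<le> m" "independent_switches M {..<m} s"
    by blast
  then show "\<exists>m\<ge>n. \<exists>d. dial M m d"
    using dial_of_independent_switches[of m s] by (intro exI[of _ "Suc m"]) auto
next
  interpret kripke_model M by fact
  fix n
  assume "\<forall>n. \<exists>m\<ge>n. \<exists>d. dial M m d"
  \<comment> \<open>A dial of size at least \<open>2 ^ n\<close> yields exactly \<open>n\<close>
    switches.\<close>
  then show "\<exists>m\<ge>n. \<exists>s :: nat \<Rightarrow> 'f. independent_switches M {..<m} s"
    using independent_switches_of_dial by blast
qed

end
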